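(* Let $G$ be a nontrivial connected graph and $H$ a nontrivial graph. (1) If both $G$ and $H$ are complete, then $pvc(G\circ H)=0$; if $diam(G)\geq3$, then $pvc(G\circ H)=2$; otherwise $pvc(G\circ H)=1$. (2) If both $G$ and $H$ are complete, then $spvc(G\circ H)=0$; if $diam(G)\geq3$, then $spvc(G\circ H)=2$; otherwise $spvc(G\circ H)=1$. (3) Suppose in addition that $H$ is connected. If $diam(G)\geq3$, then $pvc_2(G\circ H)=2$; otherwise $pvc_2(G\circ H)=1$.
   Context: All graphs are simple, finite and undirected; nontrivial means having at least two vertices. The lexicographic product $G\circ H$ has vertex set $V(G)\times V(H)$, with $(g,h)$ adjacent to $(g',h')$ iff $gg'\in E(G)$, or $g=g'$ and $hh'\in E(H)$. A set of paths between two vertices is called disjoint if they are internally vertex-disjoint. In a vertex-colored graph, a path is vertex-proper if any two adjacent internal vertices of the path receive different colors. A vertex-colored graph is proper vertex $k$-connected if any two vertices are joined by $k$ disjoint vertex-proper paths. For a $k$-connected graph $G$, $pvc_k(G)$ is the smallest number of colors in a vertex-coloring making $G$ proper vertex $k$-connected; $pvc(G)=pvc_1(G)$, with $pvc(G)=0$ for complete $G$ (for $k\ge2$, $pvc_k(G)\ge1$). A $u$-$v$ geodesic is a $u$-$v$ path of length $d(u,v)$. A vertex-colored graph is strong proper vertex-connected if for any two vertices $u,v$ there is a vertex-proper $u$-$v$ geodesic; $spvc(G)$ is the smallest number of colors needed for this, with $spvc(G)=0$ for complete $G$. *)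

theory Defs
  imports Graph_Theory.Graph_Theory "HOL-Library.Extended_Nat"
begin

text \<open>
  A simple finite undirected graph is a \<open>pair_graph\<close>: a finite, loop-free, symmetric set of
  pairs over a finite vertex set. Paths are \<open>apath\<close>s, given by their list of arcs, so
  \<open>length p\<close> is the usual length of a path and \<open>inner_verts p\<close> lists its internal vertices in
  path order.
\<close>

definition lex_product ::
  "'a pair_pre_digraph \<Rightarrow> 'b pair_pre_digraph \<Rightarrow> ('a \<times> 'b) pair_pre_digraph" where
  "lex_product G H = \<lparr> pverts = pverts G \<times> pverts H,
     parcs = {((g, h), (g', h')) | g h g' h'.
       g \<in> pverts G \<and> g' \<in> pverts G \<and> h \<in> pverts H \<and> h' \<in> pverts H \<and>
       ((g, g') \<in> parcs G \<or> g = g' \<and> (h, h') \<in> parcs H)} \<rparr>"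

definition complete_graph :: "'a pair_pre_digraph \<Rightarrow> bool" where
  "complete_graph G \<longleftrightarrow> complete_digraph (card (pverts G)) (with_proj G)"

text \<open>
  \<open>\<mu>\<close> takes an infimum over walks; with unit weights it is the length of a shortest path, and
  \<open>\<infinity>\<close> between different components.
\<close>

definition graph_dist :: "'a pair_pre_digraph \<Rightarrow> 'a \<Rightarrow> 'a \<Rightarrow> ereal" where
  "graph_dist G u v = wf_digraph.\<mu> (with_proj G) (\<lambda>_. 1) u v"

definition diam :: "'a pair_pre_digraph \<Rightarrow> ereal" where
  "diam G = (SUP u\<in>pverts G. SUP v\<in>pverts G. graph_dist G u v)"

definition geodesic :: "'a pair_pre_digraph \<Rightarrow> 'a \<Rightarrow> ('a \<times> 'a) awalk \<Rightarrow> 'a \<Rightarrow> bool" where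
  "geodesic G u p v \<longleftrightarrow>
     pre_digraph.apath (with_proj G) u p v \<and> ereal (real (length p)) = graph_dist G u v"

text \<open>Adjacency in the following definition is adjacency along the path.\<close>

definition vertex_proper ::
  "'a pair_pre_digraph \<Rightarrow> ('a \<Rightarrow> nat) \<Rightarrow> ('a \<times> 'a) awalk \<Rightarrow> bool" where
  "vertex_proper G c p \<longleftrightarrow>
     successively (\<lambda>x y. c x \<noteq> c y) (pre_digraph.inner_verts (with_proj G) p)"

definition internally_disjoint ::
  "'a pair_pre_digraph \<Rightarrow> ('a \<times> 'a) awalk set \<Rightarrow> bool" where
  "internally_disjoint G P \<longleftrightarrow>
     pairwise (\<lambda>p q. disjnt (set (pre_digraph.inner_verts (with_proj G) p))
                           (set (pre_digraph.inner_verts (with_proj G) q))) P"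

definition proper_vertex_connected ::
  "nat \<Rightarrow> 'a pair_pre_digraph \<Rightarrow> ('a \<Rightarrow> nat) \<Rightarrow> bool" where
  "proper_vertex_connected k G c \<longleftrightarrow>
     (\<forall>u\<in>pverts G. \<forall>v\<in>pverts G. u \<noteq> v \<longrightarrow>
        (\<exists>P. finite P \<and> card P = k \<and> internally_disjoint G P \<and>
             (\<forall>p\<in>P. pre_digraph.apath (with_proj G) u p v \<and> vertex_proper G c p)))"

definition strong_proper_vertex_connected ::
  "'a pair_pre_digraph \<Rightarrow> ('a \<Rightarrow> nat) \<Rightarrow> bool" where
  "strong_proper_vertex_connected G c \<longleftrightarrow>
     (\<forall>u\<in>pverts G. \<forall>v\<in>pverts G. u \<noteq> v \<longrightarrow> (\<exists>p. geodesic G u p v \<and> vertex_proper G c p))"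

text \<open>
  The infima below range over extended naturals: the value is \<open>\<infinity>\<close> exactly when no suitable
  colouring exists, so a finite value includes the existence of an optimal colouring.
\<close>

definition pvc_k :: "nat \<Rightarrow> 'a pair_pre_digraph \<Rightarrow> enat" where
  "pvc_k k G = (if k = 1 \<and> complete_graph G then 0
     else INF c\<in>{c. proper_vertex_connected k G c}. enat (card (c ` pverts G)))"

definition pvc :: "'a pair_pre_digraph \<Rightarrow> enat" where
  "pvc G = pvc_k 1 G"

definition spvc :: "'a pair_pre_digraph \<Rightarrow> enat" where
  "spvc G = (if complete_graph G then 0
     else INF c\<in>{c. strong_proper_vertex_connected G c}. enat (card (c ` pverts G)))"

end

theory Submission
  imports Defs
begin

text \<open>
  A geodesic of \<open>G\<close> between different layers lifts to a geodesic of the product whose internal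
  vertices may be put in the two copies \<open>a\<close> and \<open>b\<close> of \<open>G\<close> alternately. Giving copy \<open>a\<close> one
  colour and everything else another one makes the lift vertex-proper, and exchanging \<open>a\<close> and \<open>b\<close>
  yields a second lift that is internally disjoint from the first. All remaining paths
  have at most one internal vertex. Conversely, two colours are needed for vertices over
  points at distance at least 3, since walks in the product project to walks of \<open>G\<close>
  that are not longer.
\<close>

section \<open>Paths described by vertex functions\<close>

text \<open>Indexing the vertices turns adjacency, simplicity and colour conditions along a path
  into statements about \<open>f i\<close> and \<open>f (Suc i)\<close>; the internal vertices are
  those with index from 1 to \<open>n - 1\<close>.\<close>

definition vpath :: "(nat \<Rightarrow> 'a) \<Rightarrow> nat \<Rightarrow> ('a \<times> 'a) awalk" where
  "vpath f n = map (\<lambda>i. (f i, f (Suc i))) [0..<n]"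

lemma length_vpath [simp]: "length (vpath f n) = n"
  by (simp add: vpath_def)

lemma inner_verts_vpath [simp]:
  "pre_digraph.inner_verts (with_proj G) (vpath f n) = map f [1..<n]"
  by (simp add: inner_verts_with_proj_def vpath_def comp_def map_tl[symmetric])

lemma pawalk_verts_vpath: "pawalk_verts (f 0) (vpath f n) = map f [0..<Suc n]"
proof -
  \<comment> \<open>This formula holds for every list of pairs, whether or not it is a walk, so a
    plain list induction proves it; the start vertex \<open>u\<close> only matters for the empty
    list.\<close>
  have "pawalk_verts u p = (if p = [] then [u] else map fst p @ [snd (last p)])"
    for u :: 'a and p
    by (induction p arbitrary: u) auto
  then show ?thesis
    by (cases n) (auto simp: vpath_def comp_def)
qed

lemma successively_map_upt:
  "successively R (map f [m..<n]) \<longleftrightarrow> (\<forall>i. m \<le> i \<and> Suc i < n \<longrightarrow> R (f i) (f (Suc i)))"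
  unfolding successively_conv_nth
  by (force simp: nth_Cons' le_iff_add less_diff_conv add_ac)

context pair_wf_digraph
begin

text \<open>Induction on \<open>n\<close> appends one arc at the end, and injectivity on
  \<open>{..n}\<close> is distinctness of the \<open>Suc n\<close> visited vertices. Membership of
  \<open>f 0\<close> settles \<open>n = 0\<close>, where no arc vouches for it.\<close>

lemma apath_vpath:
  assumes "f 0 \<in> pverts G" "\<And>i. i < n \<Longrightarrow> (f i, f (Suc i)) \<in> parcs G" "inj_on f {..n}"
  shows "apath (f 0) (vpath f n) (f n)"
proof -
  have "awalk (f 0) (vpath f n) (f n)"
    using assms(1,2)
  proof (induction n)
    case 0
    then show ?case by (simp add: vpath_def awalk_Nil_iff)
  next
    case (Suc n)
    have "awalk (f n) [(f n, f (Suc n))] (f (Suc n))"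
      using Suc.prems(2)[of n] by (auto simp: awalk_simps intro: in_arcsD1 in_arcsD2)
    with Suc show ?case by (auto simp: vpath_def intro: awalk_appendI)
  qed
  moreover have "distinct (map f [0..<Suc n])"
    using assms(3) by (simp only: distinct_map) (simp add: atLeast0_lessThan_Suc atLeast0LessThan lessThan_Suc_atMost flip: lessThan_Suc)
  ultimately show ?thesis
    by (simp only: apath_def pawalk_verts_vpath)
qed

text \<open>Converse to \<open>apath_vpath\<close>: indexing into the vertex list of the path gives
  \<open>f\<close>, so geodesics found abstractly can be lifted index by index.\<close>

lemma apath_verts_function:
  assumes "apath u p v"
  obtains f where "f 0 = u" "f (length p) = v" "\<And>i. i < length p \<Longrightarrow> (f i, f (Suc i)) \<in> parcs G"
    "inj_on f {..length p}"
proof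
  let ?f = "\<lambda>i. pawalk_verts u p ! i"
  have w: "awalk u p v" and d: "distinct (pawalk_verts u p)"
    using assms by (auto simp: apath_def)
  have len: "length (pawalk_verts u p) = Suc (length p)"
    by (rule length_awalk_verts)
  have *: "?f 0 = u \<and> ?f (length p) = v \<and> (\<forall>i < length p. (?f i, ?f (Suc i)) \<in> parcs G)"
    using w
  proof (induction p arbitrary: u)
    case Nil
    then show ?case by (simp add: awalk_Nil_iff)
  next
    case (Cons e p)
    then have e: "e \<in> parcs G" "fst e = u" and IH: "awalk (snd e) p v"
      by (auto simp: awalk_Cons_iff)
    show ?case
      using Cons.IH[OF IH] e by (auto simp: nth_Cons' less_Suc_eq_0_disj)
  qed
  then show "?f 0 = u" "?f (length p) = v" "\<And>i. i < length p \<Longrightarrow> (?f i, ?f (Suc i)) \<in> parcs G"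
    by auto
  show "inj_on ?f {..length p}"
    using d len by (auto intro!: inj_on_nth)
qed

section \<open>Distances, geodesics and the diameter\<close>

lemma awalk_cost_one: "awalk_cost (\<lambda>_. 1) p = real (length p)"
  by (induction p) (auto simp: awalk_cost_def)

lemma graph_dist_le: "awalk u p v \<Longrightarrow> graph_dist G u v \<le> ereal (real (length p))"
  unfolding graph_dist_def using min_cost_le_walk_cost[of u p v "\<lambda>_. 1"]
  by (simp add: awalk_cost_one)

text \<open>Because \<open>graph_dist\<close> is an infimum over walks, the competitors
  \<open>q\<close> range over walks. This suits the product, where walks project to walks but paths
  need not project to paths.\<close>

lemma geodesicI:
  assumes "apath u p v" "\<And>q. awalk u q v \<Longrightarrow> length p \<le> length q"
  shows "geodesic G u p v"
proof -
  have "awalk u p v" using assms(1) by (simp add: apath_def)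
  moreover have "ereal (real (length p)) \<le> graph_dist G u v"
    unfolding graph_dist_def \<mu>_def using assms(2)
    by (auto intro!: INF_greatest simp: awalk_cost_one)
  ultimately show ?thesis
    unfolding geodesic_def using assms(1) graph_dist_le by (auto intro: antisym)
qed

lemma geodesicD:
  assumes "geodesic G u p v"
  shows "apath u p v" "awalk u q v \<Longrightarrow> length p \<le> length q"
proof -
  show "apath u p v" using assms by (simp add: geodesic_def)
  show "length p \<le> length q" if "awalk u q v"
  proof -
    have "ereal (real (length p)) \<le> ereal (real (length q))"
      using assms graph_dist_le[OF that] by (simp add: geodesic_def)
    then show ?thesis by simp
  qed
qed

lemma length_awalk_ge_2:
  assumes "awalk u q v" "u \<noteq> v" "(u, v) \<notin> parcs G"
  shows "2 \<le> length q"
proof (rule ccontr)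
  assume "\<not> 2 \<le> length q"
  then have "q = [] \<or> (\<exists>e. q = [e])"
    \<comment> \<open>The borrowed case rule splits a list into empty, singleton and at least two
      elements.\<close>
    by (cases q rule: remdups_adj.cases) auto
  then show False
    using assms by (auto simp: awalk_simps)
qed

lemma length_awalk_ge_1:
  assumes "awalk u q v" "u \<noteq> v"
  shows "1 \<le> length q"
  using assms by (cases q) (auto simp: awalk_simps)

text \<open>Walk lengths are integers: if every pair had a walk of length below 3, all distances and
  hence their supremum would be at most 2. So a supremum of at least 3 is witnessed by a single
  pair.\<close>

lemma diam_ge_3D:
  assumes "diam G \<ge> 3"
  shows "\<exists>u\<in>pverts G. \<exists>v\<in>pverts G. \<forall>q. awalk u q v \<longrightarrow> 3 \<le> length q"
proof (rule ccontr)
  assume "\<not> ?thesis"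
  then have *: "\<exists>q. awalk u q v \<and> length q \<le> 2" if "u \<in> pverts G" "v \<in> pverts G" for u v
    using that by (metis not_less_eq_eq numeral_2_eq_2 numeral_3_eq_3)
  have "graph_dist G u v \<le> 2" if uv: "u \<in> pverts G" "v \<in> pverts G" for u v
  proof -
    obtain q where "awalk u q v" "length q \<le> 2" using *[OF uv] by blast
    then have "graph_dist G u v \<le> ereal (real (length q))" by (simp add: graph_dist_le)
    also have "\<dots> \<le> ereal 2" using \<open>length q \<le> 2\<close> by simp
    finally show ?thesis by simp
  qed
  then have "diam G \<le> 2"
    unfolding diam_def by (auto intro!: SUP_least)
  with assms have "(3 :: ereal) \<le> 2" by (rule order_trans)
  then show False by simp
qed

lemma geodesic_length_le_2:
  assumes "\<not> diam G \<ge> 3" "geodesic G u p v"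
  shows "length p \<le> 2"
proof (rule ccontr)
  assume "\<not> length p \<le> 2"
  have w: "awalk u p v" using geodesicD[OF assms(2)] by (simp add: apath_def)
  then have "u \<in> pverts G" "v \<in> pverts G" by auto
  have "(3 :: ereal) = ereal 3" by simp
  also have "\<dots> \<le> ereal (real (length p))"
    using \<open>\<not> length p \<le> 2\<close> by simp
  also have "\<dots> = graph_dist G u v" using assms(2) by (simp add: geodesic_def)
  also have "\<dots> \<le> diam G"
    unfolding diam_def using \<open>u \<in> pverts G\<close> \<open>v \<in> pverts G\<close> by (auto intro: SUP_upper2)
  finally show False using assms(1) by simp
qed

lemma apath_two_arcs:
  assumes "(u, w) \<in> parcs G" "(w, v) \<in> parcs G" "u \<noteq> v" "u \<noteq> w" "w \<noteq> v"
  shows "apath u [(u, w), (w, v)] v"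
  using assms by (auto simp: apath_def awalk_simps intro: in_arcsD1 in_arcsD2)

lemma apath_one_arc:
  assumes "(u, v) \<in> parcs G" "u \<noteq> v"
  shows "apath u [(u, v)] v"
  using assms by (auto simp: apath_def awalk_simps intro: in_arcsD1 in_arcsD2)

end

context pair_graph
begin

text \<open>\<open>connected\<close> speaks of reachability in the symmetric closure, which agrees
  with reachability here since the arcs are symmetric. Unit weights exclude negative cycles, so the
  infimum over walks is attained by a path.\<close>

lemma geodesic_exists:
  assumes "connected (with_proj G)" "u \<in> pverts G" "v \<in> pverts G"
  shows "\<exists>p. geodesic G u p v"
proof -
  have "u \<rightarrow>\<^sup>*\<^bsub>with_proj G\<^esub> v"
    using assms by (auto simp: connected_def strongly_connected_def reachable_mk_symmetric_eq[OF pair_sym_arcs])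
  moreover have "awalk_cost (\<lambda>_. 1) p \<ge> 0" for p
    by (simp add: awalk_cost_one)
  ultimately show ?thesis
    using no_neg_cyc_reach_imp_path[of u v "\<lambda>_. 1"]
    by (fastforce simp: geodesic_def graph_dist_def awalk_cost_one not_less)
qed

lemma neighbour_exists:
  assumes "connected (with_proj G)" "card (pverts G) \<ge> 2" "u \<in> pverts G"
  shows "\<exists>v. (u, v) \<in> parcs G"
proof -
  have "pverts G \<noteq> {u}" using assms(2) by auto
  then obtain v where "v \<in> pverts G" "v \<noteq> u" using assms(3) by blast
  then obtain p where "awalk u p v"
    using geodesic_exists[OF assms(1,3)] geodesicD by (metis apath_def)
  with \<open>v \<noteq> u\<close> show ?thesis
    by (cases p) (auto simp: awalk_simps)
qed

end

section \<open>The product as a simple graph\<close>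

lemma pair_graph_lex_product:
  assumes "pair_graph G" "pair_graph H"
  shows "pair_graph (lex_product G H)"
proof -
  interpret G: pair_graph G by fact
  interpret H: pair_graph H by fact
  have fin: "finite (pverts G \<times> pverts H)"
    using G.pair_finite_verts H.pair_finite_verts by simp
  have sub: "parcs (lex_product G H) \<subseteq> (pverts G \<times> pverts H) \<times> (pverts G \<times> pverts H)"
    by (auto simp: lex_product_def)
  show ?thesis
  proof unfold_locales
    show "finite (pverts (lex_product G H))" using fin by (simp add: lex_product_def)
    show "finite (parcs (lex_product G H))" using fin sub by (meson finite_SigmaI finite_subset)
    show "fst e \<in> pverts (lex_product G H)" "snd e \<in> pverts (lex_product G H)"
      if "e \<in> parcs (lex_product G H)" for e
      using that by (auto simp: lex_product_def)
    show "symmetric (with_proj (lex_product G H))"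
      unfolding symmetric_def
      by (auto simp: lex_product_def intro!: symI intro: G.arcs_symmetric H.arcs_symmetric)
    show "fst e \<noteq> snd e" if "e \<in> parcs (lex_product G H)" for e
      using that by (auto simp: lex_product_def dest: G.no_loops' H.no_loops')
  qed
qed

lemma complete_graph_iff:
  assumes "pair_graph G"
  shows "complete_graph G \<longleftrightarrow> (\<forall>u\<in>pverts G. \<forall>v\<in>pverts G. u \<noteq> v \<longrightarrow> (u, v) \<in> parcs G)"
proof -
  interpret pair_graph G by fact
  show ?thesis
    unfolding complete_graph_def complete_digraph_pair_def
    using pair_finite_verts by (auto dest: in_arcsD1 in_arcsD2 no_loops')
qed

text \<open>Distinct vertices over one point of \<open>G\<close> can be adjacent only through
  \<open>H\<close>, because \<open>G\<close> has no loops; over different points only through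
  \<open>G\<close>. The nonempty vertex sets supply the coordinate at which the other factor is
  embedded.\<close>

lemma complete_graph_lex_product_iff:
  assumes "pair_graph G" "pair_graph H" "pverts G \<noteq> {}" "pverts H \<noteq> {}"
  shows "complete_graph (lex_product G H) \<longleftrightarrow> complete_graph G \<and> complete_graph H"
proof -
  interpret G: pair_graph G by fact
  interpret H: pair_graph H by fact
  obtain g h where gh: "g \<in> pverts G" "h \<in> pverts H" using assms(3,4) by blast
  show ?thesis
    unfolding complete_graph_iff[OF pair_graph_lex_product[OF assms(1,2)]]
      complete_graph_iff[OF assms(1)] complete_graph_iff[OF assms(2)]
    by (intro iffI conjI ballI impI; clarsimp simp: lex_product_def)
      (use gh G.no_loops' in \<open>metis+\<close>)
qed

section \<open>Lifting geodesics to the product\<close>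

text \<open>The ends are set separately because they are prescribed vertices with arbitrary second
  coordinates; only the internal indices alternate between the copies.\<close>

definition lift :: "(nat \<Rightarrow> 'a) \<Rightarrow> nat \<Rightarrow> 'a \<times> 'b \<Rightarrow> 'a \<times> 'b \<Rightarrow> 'b \<Rightarrow> 'b \<Rightarrow> nat \<Rightarrow> 'a \<times> 'b" where
  "lift f n w w' a b i =
     (if i = 0 then w else if i = n then w' else (f i, if even i then a else b))"

lemma inner_verts_lift:
  "pre_digraph.inner_verts (with_proj K) (vpath (lift f n w w' a b) n) =
     map (\<lambda>i. (f i, if even i then a else b)) [1..<n]"
  by (simp add: lift_def)

text \<open>For \<open>n \<le> 2\<close> there is at most one internal vertex, hence nothing to
  compare. Otherwise consecutive indices have opposite parity, so one vertex lies in copy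
  \<open>a\<close> and the other in copy \<open>b\<close>.\<close>

lemma vertex_proper_lift:
  assumes "n \<le> 2 \<or> (\<forall>g g'. c (g, a) \<noteq> c (g', b))"
  shows "vertex_proper K c (vpath (lift f n w w' a b) n)"
  unfolding vertex_proper_def inner_verts_lift successively_map_upt
  using assms by (auto; metis)

locale lex_graphs = G: pair_graph G + H: pair_graph H
  for G :: "'a pair_pre_digraph" and H :: "'b pair_pre_digraph" +
  assumes G_nontrivial: "card (pverts G) \<ge> 2" and G_connected: "connected (with_proj G)"
    and H_nontrivial: "card (pverts H) \<ge> 2"
begin

abbreviation L :: "('a \<times> 'b) pair_pre_digraph" where
  "L \<equiv> lex_product G H"

sublocale L: pair_graph "lex_product G H"
  by (intro pair_graph_lex_product) auto

lemma pverts_L [simp]: "pverts L = pverts G \<times> pverts H"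
  by (simp add: lex_product_def)

lemma parcs_L_iff:
  "((g, h), (g', h')) \<in> parcs L \<longleftrightarrow> g \<in> pverts G \<and> g' \<in> pverts G \<and> h \<in> pverts H \<and> h' \<in> pverts H \<and>
     ((g, g') \<in> parcs G \<or> g = g' \<and> (h, h') \<in> parcs H)"
  by (auto simp: lex_product_def)

text \<open>Each arc of the product projects either to an arc of \<open>G\<close> or to a single
  vertex, and in the latter case it is dropped.\<close>

lemma awalk_fst:
  assumes "L.awalk u p v"
  shows "\<exists>q. G.awalk (fst u) q (fst v) \<and> length q \<le> length p"
  using assms
proof (induction p arbitrary: u)
  case Nil
  then have "G.awalk (fst u) [] (fst v)" by (auto simp: L.awalk_simps G.awalk_simps)
  then show ?case by auto
next
  case (Cons e p)
  then have e: "e \<in> parcs L" "fst e = u" and "L.awalk (snd e) p v"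
    by (auto simp: L.awalk_simps)
  then obtain q where q: "G.awalk (fst (snd e)) q (fst v)" "length q \<le> length p"
    using Cons.IH by blast
  obtain g h g' h' where "e = ((g, h), (g', h'))" by (metis surj_pair)
  with e consider "(fst u, fst (snd e)) \<in> parcs G" | "fst (snd e) = fst u"
    by (auto simp: parcs_L_iff)
  then show ?case
  proof cases
    case 1
    with q(1) have "G.awalk (fst u) ((fst u, fst (snd e)) # q) (fst v)"
      by (simp add: G.awalk_simps)
    with q(2) show ?thesis by (metis Suc_le_mono length_Cons)
  next
    case 2
    with q show ?thesis by (metis le_SucI length_Cons)
  qed
qed

text \<open>Arcs of \<open>G\<close> join all vertices over their ends, so second coordinates can be
  chosen freely. Distinctness is inherited from the first coordinates, and minimality from
  projecting competitors by \<open>awalk_fst\<close>.\<close>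

lemma geodesic_lift:
  assumes f: "\<And>i. i < n \<Longrightarrow> (f i, f (Suc i)) \<in> parcs G" "inj_on f {..n}"
    and min: "\<And>q. G.awalk (f 0) q (f n) \<Longrightarrow> n \<le> length q"
    and "0 < n" "a \<in> pverts H" "b \<in> pverts H"
    and w: "w \<in> pverts L" "fst w = f 0" "w' \<in> pverts L" "fst w' = f n"
  shows "geodesic L w (vpath (lift f n w w' a b) n) w'"
proof (rule L.geodesicI)
  let ?F = "lift f n w w' a b"
  have fst_F: "fst (?F i) = f i" if "i \<le> n" for i
    using w by (auto simp: lift_def)
  have snd_F: "snd (?F i) \<in> pverts H" for i
    using w assms(5,6) by (auto simp: lift_def)
  \<comment> \<open>For \<open>n = 0\<close> the test \<open>i = 0\<close> would win and the path
    would end in \<open>w\<close> instead of \<open>w'\<close>.\<close>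
  have ends: "?F 0 = w" "?F n = w'"
    using \<open>0 < n\<close> by (auto simp: lift_def)
  have "inj_on (fst \<circ> ?F) {..n}"
    using f(2) fst_F by (auto simp: inj_on_def)
  then have "inj_on ?F {..n}" by (rule inj_on_imageI2)
  moreover have "(?F i, ?F (Suc i)) \<in> parcs L" if "i < n" for i
  proof -
    have "(fst (?F i), fst (?F (Suc i))) \<in> parcs G"
      using f(1)[OF that] fst_F[of i] fst_F[of "Suc i"] that by simp
    then show ?thesis
      using snd_F[of i] snd_F[of "Suc i"] by (metis parcs_L_iff prod.collapse G.in_arcsD1 G.in_arcsD2)
  qed
  ultimately have "L.apath (?F 0) (vpath ?F n) (?F n)"
    using w ends by (intro L.apath_vpath) auto
  then show "L.apath w (vpath ?F n) w'" by (simp only: ends)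
  show "length (vpath ?F n) \<le> length q" if "L.awalk w q w'" for q
    using awalk_fst[OF that] min w by fastforce
qed

lemma geodesic_function:
  assumes "g \<in> pverts G" "g' \<in> pverts G" "g \<noteq> g'"
  obtains f n where "0 < n" "f 0 = g" "f n = g'" "\<And>i. i < n \<Longrightarrow> (f i, f (Suc i)) \<in> parcs G"
    "inj_on f {..n}" "\<And>q. G.awalk g q g' \<Longrightarrow> n \<le> length q" "\<not> diam G \<ge> 3 \<Longrightarrow> n \<le> 2"
proof -
  obtain p where p: "geodesic G g p g'"
    using G.geodesic_exists[OF G_connected assms(1,2)] by blast
  obtain f where f: "f 0 = g" "f (length p) = g'" "\<And>i. i < length p \<Longrightarrow> (f i, f (Suc i)) \<in> parcs G"
    "inj_on f {..length p}"
    using G.apath_verts_function[OF G.geodesicD(1)[OF p]] by blast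
  moreover from f assms(3) have "0 < length p" by (cases p) auto
  ultimately show ?thesis
    using that G.geodesicD(2)[OF p] G.geodesic_length_le_2[OF _ p] by blast
qed

lemma neighbour_G:
  assumes "g \<in> pverts G"
  obtains g' where "(g, g') \<in> parcs G" "(g', g) \<in> parcs G" "g' \<in> pverts G" "g' \<noteq> g"
  using G.neighbour_exists[OF G_connected G_nontrivial assms]
  by (metis G.arcs_symmetric G.in_arcsD2 G.no_loops')

section \<open>Colourings that suffice\<close>

text \<open>The disjunction on \<open>c\<close> covers both regimes at once: with small diameter the
  lifts are too short to violate properness, otherwise the two copies have disjoint colour
  sets.\<close>

lemma strong_proper_vertex_connected_L:
  assumes ab: "a \<in> pverts H" "b \<in> pverts H"
    and c: "\<not> diam G \<ge> 3 \<or> (\<forall>g g'. c (g, a) \<noteq> c (g', b))"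
  shows "strong_proper_vertex_connected L c"
  unfolding strong_proper_vertex_connected_def
proof (intro ballI impI)
  fix u v assume uv: "u \<in> pverts L" "v \<in> pverts L" "u \<noteq> v"
  show "\<exists>p. geodesic L u p v \<and> vertex_proper L c p"
  proof (cases "fst u = fst v")
    case False
    have "fst u \<in> pverts G" "fst v \<in> pverts G" using uv by auto
    from this False obtain f n where f: "0 < n" "f 0 = fst u" "f n = fst v"
      "\<And>i. i < n \<Longrightarrow> (f i, f (Suc i)) \<in> parcs G" "inj_on f {..n}"
      "\<And>q. G.awalk (fst u) q (fst v) \<Longrightarrow> n \<le> length q" "\<not> diam G \<ge> 3 \<Longrightarrow> n \<le> 2"
      by (rule geodesic_function) blast
    have "geodesic L u (vpath (lift f n u v a b) n) v"
      using f uv ab by (intro geodesic_lift) auto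
    moreover have "vertex_proper L c (vpath (lift f n u v a b) n)"
      using f(7) c by (intro vertex_proper_lift) blast
    ultimately show ?thesis by blast
  next
    case True
    then obtain g h h' where u: "u = (g, h)" and v: "v = (g, h')" by (metis prod.collapse)
    show ?thesis
    proof (cases "(u, v) \<in> parcs L")
      case True
      have "geodesic L u [(u, v)] v"
        using True uv L.length_awalk_ge_1[of u _ v] by (intro L.geodesicI L.apath_one_arc) auto
      then show ?thesis
        by (force simp: vertex_proper_def)
    next
      case False
      have "g \<in> pverts G" using uv u by simp
      then obtain g' where g': "(g, g') \<in> parcs G" "(g', g) \<in> parcs G" "g' \<in> pverts G" "g' \<noteq> g"
        by (rule neighbour_G)
      \<comment> \<open>Any vertex over the neighbour \<open>g'\<close> is adjacent to everything
        over \<open>g\<close>; the coordinate \<open>h\<close> is merely at hand.\<close>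
      have "L.apath u [(u, (g', h)), ((g', h), v)] v"
        using g' uv by (intro L.apath_two_arcs) (auto simp: u v parcs_L_iff)
      then have "geodesic L u [(u, (g', h)), ((g', h), v)] v"
        using L.length_awalk_ge_2[OF _ uv(3) False] by (intro L.geodesicI) (simp_all add: numeral_2_eq_2)
      then show ?thesis
        by (force simp: vertex_proper_def inner_verts_with_proj_def)
    qed
  qed
qed

lemma internally_disjoint_pair:
  assumes "disjnt (set (L.inner_verts p)) (set (L.inner_verts q))"
  shows "internally_disjoint L {p, q}"
  using assms by (auto simp: internally_disjoint_def pairwise_def disjnt_sym)

lemma proper_vertex_2_connected_L:
  assumes "connected (with_proj H)"
    and ab: "a \<in> pverts H" "b \<in> pverts H" "a \<noteq> b"
    and c: "\<not> diam G \<ge> 3 \<or> (\<forall>g g'. c (g, a) \<noteq> c (g', b))"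
  shows "proper_vertex_connected 2 L c"
  unfolding proper_vertex_connected_def
proof (intro ballI impI)
  fix u v assume uv: "u \<in> pverts L" "v \<in> pverts L" "u \<noteq> v"
  define goal where "goal \<longleftrightarrow> (\<exists>P. finite P \<and> card P = 2 \<and> internally_disjoint L P \<and>
    (\<forall>p\<in>P. L.apath u p v \<and> vertex_proper L c p))"
  have two: goal if "L.apath u p v" "L.apath u q v" "p \<noteq> q" "vertex_proper L c p"
    "vertex_proper L c q" "disjnt (set (L.inner_verts p)) (set (L.inner_verts q))" for p q
    unfolding goal_def
    using that internally_disjoint_pair[of p q] by (intro exI[of _ "{p, q}"]) auto
  have short: "vertex_proper L c [(u, w), (w, v)]" "vertex_proper L c [(u, v)]"
    "L.inner_verts [(u, w), (w, v)] = [w]" for w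
    by (simp_all add: vertex_proper_def inner_verts_with_proj_def)
  obtain g h g' h' where u: "u = (g, h)" and v: "v = (g', h')" by (metis prod.collapse)
  have gh: "g \<in> pverts G" "h \<in> pverts H" "g' \<in> pverts G" "h' \<in> pverts H"
    using uv u v by auto
  consider "g = g'" | "g \<noteq> g'" "(u, v) \<in> parcs L" | "g \<noteq> g'" "(u, v) \<notin> parcs L"
    by blast
  then have goal
  proof cases
    case 1
    obtain k where k: "(g, k) \<in> parcs G" "(k, g) \<in> parcs G" "k \<in> pverts G" "k \<noteq> g"
      using gh(1) by (rule neighbour_G)
    \<comment> \<open>The choices \<open>x = a\<close> and \<open>x = b\<close> give two detours
      with different internal vertices over the same neighbour \<open>k\<close>.\<close>
    have "L.apath u [(u, (k, x)), ((k, x), v)] v" if "x \<in> pverts H" for x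
      using 1 k gh uv that by (intro L.apath_two_arcs) (auto simp: u v parcs_L_iff)
    with ab show goal
      by (intro two[of "[(u, (k, a)), ((k, a), v)]" "[(u, (k, b)), ((k, b), v)]"]) (auto simp: short)
  next
    case 2
    \<comment> \<open>Beside the direct arc a second path is needed. Connectedness of
      \<open>H\<close> provides a step inside the layer of \<open>u\<close>, and every vertex of
      that layer is adjacent to \<open>v\<close>.\<close>
    obtain x where x: "(h, x) \<in> parcs H"
      using H.neighbour_exists[OF assms(1) H_nontrivial gh(2)] by blast
    have "(g, g') \<in> parcs G" using 2 by (auto simp: u v parcs_L_iff)
    then have "L.apath u [(u, (g, x)), ((g, x), v)] v"
      using 2 x gh uv
      by (intro L.apath_two_arcs) (auto simp: u v parcs_L_iff dest: H.no_loops' H.in_arcsD2)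
    moreover have "L.apath u [(u, v)] v"
      using 2 uv by (intro L.apath_one_arc)
    ultimately show goal
      by (intro two[of "[(u, v)]" "[(u, (g, x)), ((g, x), v)]"]) (auto simp: short)
  next
    case 3
    obtain f n where f: "0 < n" "f 0 = g" "f n = g'"
      "\<And>i. i < n \<Longrightarrow> (f i, f (Suc i)) \<in> parcs G" "inj_on f {..n}"
      "\<And>q. G.awalk g q g' \<Longrightarrow> n \<le> length q" "\<not> diam G \<ge> 3 \<Longrightarrow> n \<le> 2"
      using gh(1,3) 3(1) by (rule geodesic_function) blast
    \<comment> \<open>With \<open>n = 1\<close> the ends would be adjacent. An internal vertex is
      required because \<open>card P = 2\<close> demands that the two disjoint lifts be different
      paths.\<close>
    have "n \<noteq> 1"
      using 3 f(2,3) f(4)[of 0] gh by (auto simp: u v parcs_L_iff)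
    with f(1) have "2 \<le> n" by simp
    let ?p = "\<lambda>x y. vpath (lift f n u v x y) n"
    have path: "L.apath u (?p x y) v" if "x \<in> pverts H" "y \<in> pverts H" for x y
      using f(1-6) uv that by (intro L.geodesicD(1) geodesic_lift) (auto simp: u v)
    have proper: "vertex_proper L c (?p a b)" "vertex_proper L c (?p b a)"
      using f(7) c by (intro vertex_proper_lift; metis)+
    \<comment> \<open>By injectivity of \<open>f\<close>, a common internal vertex would have the
      same index in both lifts, but there one has second coordinate \<open>a\<close> and the other
      \<open>b\<close>.\<close>
    have disj: "disjnt (set (L.inner_verts (?p a b))) (set (L.inner_verts (?p b a)))"
      unfolding inner_verts_lift using ab(3)
      by (auto simp: disjnt_iff dest: inj_onD[OF f(5)] split: if_splits)
    moreover have "set (L.inner_verts (?p a b)) \<noteq> {}"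
      unfolding inner_verts_lift using \<open>2 \<le> n\<close> by simp
    ultimately have "?p a b \<noteq> ?p b a" by (metis disjnt_self_iff_empty)
    then show goal
      using path proper disj ab by (intro two[of "?p a b" "?p b a"]) auto
  qed
  then show "\<exists>P. finite P \<and> card P = 2 \<and> internally_disjoint L P \<and>
      (\<forall>p\<in>P. L.apath u p v \<and> vertex_proper L c p)"
    by (simp add: goal_def)
qed

section \<open>Lower bounds on the number of colours\<close>

lemma card_colours_ge_2:
  assumes "proper_vertex_connected k L c" "k \<noteq> 0" "diam G \<ge> 3"
  shows "2 \<le> card (c ` pverts L)"
proof -
  obtain g g' where g: "g \<in> pverts G" "g' \<in> pverts G" "\<And>q. G.awalk g q g' \<Longrightarrow> 3 \<le> length q"
    using G.diam_ge_3D[OF assms(3)] by blast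
  then have "g \<noteq> g'"
    using G.awalk_Nil_iff[of g g'] by fastforce
  obtain h where h: "h \<in> pverts H"
    using H_nontrivial by fastforce
  have "(g, h) \<in> pverts L" "(g', h) \<in> pverts L" "(g, h) \<noteq> (g', h)"
    using g h \<open>g \<noteq> g'\<close> by auto
  with assms(1) obtain P where P: "card P = k" "\<forall>p\<in>P. L.apath (g, h) p (g', h) \<and> vertex_proper L c p"
    unfolding proper_vertex_connected_def by blast
  with assms(2) have "P \<noteq> {}" by auto
  with P obtain p where p: "L.apath (g, h) p (g', h)" "vertex_proper L c p" by blast
  then have "L.awalk (g, h) p (g', h)" by (simp add: L.apath_def)
  then have "3 \<le> length p" "set p \<subseteq> parcs L"
    using awalk_fst[of "(g, h)" p "(g', h)"] g(3) by (fastforce, auto)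
  \<comment> \<open>Three arcs are exactly what forces two consecutive internal vertices, the tails
    of the second and third arc.\<close>
  then obtain e1 e2 e3 p' where p': "p = e1 # e2 # e3 # p'"
    by (metis (no_types, lifting) Suc_le_length_iff numeral_3_eq_3)
  with p(2) have "c (fst e2) \<noteq> c (fst e3)"
    by (simp add: vertex_proper_def inner_verts_with_proj_def)
  moreover have "fst e2 \<in> pverts L" "fst e3 \<in> pverts L"
    using \<open>set p \<subseteq> parcs L\<close> p' L.arc_fst_in_verts by auto
  ultimately have "{c (fst e2), c (fst e3)} \<subseteq> c ` pverts L" "card {c (fst e2), c (fst e3)} = 2"
    by auto
  then show ?thesis
    using card_mono[of "c ` pverts L"] L.pair_finite_verts by (metis finite_imageI)
qed

lemma card_colours_ge_1: "1 \<le> card (c ` pverts L)"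
proof -
  have "c ` pverts L \<noteq> {}" using G_nontrivial H_nontrivial by fastforce
  then show ?thesis using L.pair_finite_verts by (simp add: Suc_le_eq card_gt_0_iff)
qed

lemma proper_vertex_connected_1:
  assumes "strong_proper_vertex_connected L c"
  shows "proper_vertex_connected 1 L c"
  unfolding proper_vertex_connected_def
proof (intro ballI impI)
  fix u v assume "u \<in> pverts L" "v \<in> pverts L" "u \<noteq> v"
  with assms obtain p where "geodesic L u p v" "vertex_proper L c p"
    unfolding strong_proper_vertex_connected_def by blast
  then show "\<exists>P. finite P \<and> card P = 1 \<and> internally_disjoint L P \<and>
      (\<forall>p\<in>P. L.apath u p v \<and> vertex_proper L c p)"
    by (intro exI[of _ "{p}"]) (auto simp: internally_disjoint_def dest: L.geodesicD(1))
qed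

section \<open>Values of the three parameters\<close>

text \<open>The predicate \<open>Q\<close> abstracts the notion of connectedness:
  \<open>admissible\<close> gives the upper bound, and \<open>proper\<close> reduces the lower bound
  to \<open>card_colours_ge_2\<close> with a \<open>k\<close> depending on the notion.\<close>

lemma INF_colours:
  assumes admissible: "\<And>a b c. a \<in> pverts H \<Longrightarrow> b \<in> pverts H \<Longrightarrow> a \<noteq> b \<Longrightarrow>
      \<not> diam G \<ge> 3 \<or> (\<forall>g g'. c (g, a) \<noteq> c (g', b)) \<Longrightarrow> Q c"
    and proper: "\<And>c. Q c \<Longrightarrow> \<exists>k. k \<noteq> 0 \<and> proper_vertex_connected k L c"
  shows "(INF c\<in>{c. Q c}. enat (card (c ` pverts L))) = (if diam G \<ge> 3 then 2 else 1)"
proof -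
  obtain a b where ab: "a \<in> pverts H" "b \<in> pverts H" "a \<noteq> b"
    using H_nontrivial by (metis card_2_iff' obtain_subset_with_card_n subsetD)
  obtain g where g: "g \<in> pverts G"
    using G_nontrivial by fastforce
  show ?thesis
  proof (cases "diam G \<ge> 3")
    case True
    \<comment> \<open>Copy \<open>a\<close> gets colour 0 and every other copy, \<open>b\<close>
      among them, colour 1.\<close>
    define c where "c = (\<lambda>(x :: 'a, y). if y = a then 0 else 1 :: nat)"
    have "Q c" using ab by (intro admissible[of a b]) (auto simp: c_def)
    have "c ` pverts L \<subseteq> {0, 1}" by (auto simp: c_def)
    then have "card (c ` pverts L) \<le> card {0, 1 :: nat}" by (intro card_mono) auto
    then have "card (c ` pverts L) \<le> 2" by simp
    with \<open>Q c\<close> have "(INF c\<in>{c. Q c}. enat (card (c ` pverts L))) \<le> enat 2"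
      by (auto intro: INF_lower2)
    moreover have "enat 2 \<le> (INF c\<in>{c. Q c}. enat (card (c ` pverts L)))"
      using proper card_colours_ge_2 True by (intro INF_greatest) fastforce
    ultimately show ?thesis using True by (simp add: numeral_eq_enat)
  next
    case False
    \<comment> \<open>With small diameter \<open>admissible\<close> puts no condition on the
      colouring, so a constant one attains the bound 1.\<close>
    define c where "c = (\<lambda>x :: 'a \<times> 'b. 0 :: nat)"
    have "Q c" using ab False by (intro admissible[of a b]) auto
    have "card (c ` pverts L) = 1"
      using g ab by (auto simp: c_def image_constant_conv)
    with \<open>Q c\<close> have "(INF c\<in>{c. Q c}. enat (card (c ` pverts L))) \<le> enat 1"
      by (auto intro: INF_lower2)
    moreover have "enat 1 \<le> (INF c\<in>{c. Q c}. enat (card (c ` pverts L)))"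
      using card_colours_ge_1 by (intro INF_greatest) (simp del: pverts_L)
    ultimately show ?thesis using False by (simp add: one_enat_def)
  qed
qed

text \<open>Keeps the case of large diameter apart from the conventional value 0: a complete
  \<open>G\<close> would have a one-arc walk between points at distance at least 3.\<close>

lemma not_complete_graph_G:
  assumes "diam G \<ge> 3"
  shows "\<not> complete_graph G"
proof
  assume "complete_graph G"
  obtain g g' where g: "g \<in> pverts G" "g' \<in> pverts G" "\<And>q. G.awalk g q g' \<Longrightarrow> 3 \<le> length q"
    using G.diam_ge_3D[OF assms] by blast
  then have "g \<noteq> g'"
    using G.awalk_Nil_iff[of g g'] by fastforce
  with \<open>complete_graph G\<close> g have "(g, g') \<in> parcs G"
    by (simp add: complete_graph_iff[OF G.pair_graph])
  then have "G.awalk g [(g, g')] g'" by (simp add: G.awalk_simps g)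
  then show False using g(3) by fastforce
qed

lemma complete_graph_L_iff: "complete_graph L \<longleftrightarrow> complete_graph G \<and> complete_graph H"
  using G_nontrivial H_nontrivial
  by (intro complete_graph_lex_product_iff) auto

text \<open>A vertex-proper geodesic alone is a family of one path, so the colourings for the strong
  notion serve here as well.\<close>

lemma pvc_L:
  assumes "\<not> complete_graph L"
  shows "pvc L = (if diam G \<ge> 3 then 2 else 1)"
proof -
  have "(INF c\<in>{c. proper_vertex_connected 1 L c}. enat (card (c ` pverts L))) =
      (if diam G \<ge> 3 then 2 else 1)"
    by (rule INF_colours)
      (use strong_proper_vertex_connected_L proper_vertex_connected_1 in \<open>blast, metis zero_neq_one\<close>)
  then show ?thesis using assms by (simp add: pvc_def pvc_k_def)
qed

lemma spvc_L:
  assumes "\<not> complete_graph L"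
  shows "spvc L = (if diam G \<ge> 3 then 2 else 1)"
proof -
  have "(INF c\<in>{c. strong_proper_vertex_connected L c}. enat (card (c ` pverts L))) =
      (if diam G \<ge> 3 then 2 else 1)"
    by (rule INF_colours)
      (use strong_proper_vertex_connected_L proper_vertex_connected_1 in \<open>blast+\<close>)
  then show ?thesis using assms by (simp add: spvc_def)
qed

lemma pvc_2_L:
  assumes "connected (with_proj H)"
  shows "pvc_k 2 L = (if diam G \<ge> 3 then 2 else 1)"
proof -
  have "(INF c\<in>{c. proper_vertex_connected 2 L c}. enat (card (c ` pverts L))) =
      (if diam G \<ge> 3 then 2 else 1)"
    by (rule INF_colours)
      (use proper_vertex_2_connected_L[OF assms] in \<open>blast, metis zero_neq_numeral\<close>)
  \<comment> \<open>The value 0 is reserved for \<open>k = 1\<close>, so \<open>pvc_k 2\<close> is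
    the infimum even for a complete product.\<close>
  then show ?thesis by (simp add: pvc_k_def)
qed

end

theorem theorem4p2:
  fixes G :: "'a pair_pre_digraph" and H :: "'b pair_pre_digraph"
  assumes "pair_graph G" and "card (pverts G) \<ge> 2" and "connected (with_proj G)"
    and "pair_graph H" and "card (pverts H) \<ge> 2"
  shows
    "((complete_graph G \<and> complete_graph H \<longrightarrow> pvc (lex_product G H) = 0) \<and>
      (diam G \<ge> 3 \<longrightarrow> pvc (lex_product G H) = 2) \<and>
      (\<not> (complete_graph G \<and> complete_graph H) \<and> \<not> diam G \<ge> 3 \<longrightarrow> pvc (lex_product G H) = 1)) \<and>
     ((complete_graph G \<and> complete_graph H \<longrightarrow> spvc (lex_product G H) = 0) \<and>
      (diam G \<ge> 3 \<longrightarrow> spvc (lex_product G H) = 2) \<and>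
      (\<not> (complete_graph G \<and> complete_graph H) \<and> \<not> diam G \<ge> 3 \<longrightarrow> spvc (lex_product G H) = 1)) \<and>
     (connected (with_proj H) \<longrightarrow>
      (diam G \<ge> 3 \<longrightarrow> pvc_k 2 (lex_product G H) = 2) \<and>
      (\<not> diam G \<ge> 3 \<longrightarrow> pvc_k 2 (lex_product G H) = 1))"
proof -
  interpret lex_graphs G H
    using assms by (simp add: lex_graphs_def lex_graphs_axioms_def)
  show ?thesis
    using not_complete_graph_G pvc_L spvc_L pvc_2_L complete_graph_L_iff
    by (auto simp: pvc_def pvc_k_def spvc_def)
qed

end
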